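(* Let $f:\mathbb{R}^D\to\mathbb{R}$ be continuous, attain its global minimum $f^*$, and have effective dimensionality $d_e\le d$ with effective subspace $\mathcal{T}$ spanned by the columns of $\boldsymbol{U}\in\mathbb{R}^{D\times d_e}$. Let $\boldsymbol{x}^*\in\mathcal{G}$ be a global minimizer whose projection $\boldsymbol{x}_\top^*=\boldsymbol{U}\boldsymbol{U}^T\boldsymbol{x}^*$ is non-zero, let $\mathcal{G}^*=\boldsymbol{x}_\top^*+\mathcal{T}^\perp$, let $\boldsymbol{A}$ be a $D\times d$ Gaussian matrix, and let $\boldsymbol{y}_2^*$ be the minimal Euclidean norm element of $S^*=\{\boldsymbol{y}\in\mathbb{R}^d:\boldsymbol{A}\boldsymbol{y}\in\mathcal{G}^*\}$. Then $$\frac{\|\boldsymbol{x}_\top^*\|_2^2}{\|\boldsymbol{y}_2^*\|_2^2}\sim\chi^2_{d-d_e+1}.$$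
   Context: Effective dimensionality: $f:\mathbb{R}^D\to\mathbb{R}$ has effective dimensionality $d_e\le D$ if there is a linear subspace $\mathcal{T}\subseteq\mathbb{R}^D$ of dimension $d_e$ such that $f(\boldsymbol{x}_\top+\boldsymbol{x}_\perp)=f(\boldsymbol{x}_\top)$ for all $\boldsymbol{x}_\top\in\mathcal{T}$ and $\boldsymbol{x}_\perp\in\mathcal{T}^\perp$, and $d_e$ is the smallest integer with this property. $\mathcal{T}$ is called the effective subspace and $\mathcal{T}^\perp$ the constant subspace. The matrices $\boldsymbol{U}\in\mathbb{R}^{D\times d_e}$ and $\boldsymbol{V}\in\mathbb{R}^{D\times(D-d_e)}$ have orthonormal columns spanning $\mathcal{T}$ and $\mathcal{T}^\perp$ respectively. $\mathcal{G}=\{\boldsymbol{x}\in\mathbb{R}^D: f(\boldsymbol{x})=f^*\}$ is the set of global minimizers, where $f^*=\min_{\boldsymbol{x}\in\mathbb{R}^D} f(\boldsymbol{x})$. A Gaussian matrix is a random matrix whose entries are independent standard normal random variables. $\chi^2_n$ is the chi-squared distribution with $n$ degrees of freedom. The random vector $\boldsymbol{y}_2^*=\arg\min\{\|\boldsymbol{y}\|_2:\boldsymbol{y}\in S^*\}$ is understood to be defined on the probability-one event that $S^*$ is nonempty. *)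

theory Defs
  imports "HOL-Probability.Probability"
begin

definition constant_along_complement ::
  "(real ^ 'D \<Rightarrow> real) \<Rightarrow> (real ^ 'D) set \<Rightarrow> bool" where
  "constant_along_complement f T \<longleftrightarrow>
     subspace T \<and> (\<forall>x\<in>T. \<forall>z\<in>T\<^sup>\<bottom>. f (x + z) = f x)"

(* The set of admissible dimensions contains CARD('D) (take T = UNIV), so LEAST is well-defined. *)
definition effective_dim :: "(real ^ 'D \<Rightarrow> real) \<Rightarrow> nat" where
  "effective_dim f = (LEAST n. \<exists>T. constant_along_complement f T \<and> dim T = n)"

definition effective_subspace ::
  "(real ^ 'D \<Rightarrow> real) \<Rightarrow> (real ^ 'D) set \<Rightarrow> bool" where
  "effective_subspace f T \<longleftrightarrow> constant_along_complement f T \<and> dim T = effective_dim f"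

definition attains_global_min :: "('a \<Rightarrow> real) \<Rightarrow> real \<Rightarrow> bool" where
  "attains_global_min f m \<longleftrightarrow> m \<in> range f \<and> (\<forall>x. m \<le> f x)"

definition orthonormal_columns :: "real ^ 'e ^ 'D \<Rightarrow> bool" where
  "orthonormal_columns U \<longleftrightarrow>
     (\<forall>i j. column i U \<bullet> column j U = (if i = j then 1 else 0))"

definition gaussian_matrix :: "'w measure \<Rightarrow> ('w \<Rightarrow> real ^ 'd ^ 'D) \<Rightarrow> bool" where
  "gaussian_matrix M A \<longleftrightarrow>
     prob_space.indep_vars M (\<lambda>_. borel) (\<lambda>(i, j) \<omega>. A \<omega> $ i $ j) UNIV \<and>
     (\<forall>i j. distributed M lborel (\<lambda>\<omega>. A \<omega> $ i $ j) std_normal_density)"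

(* The law of the sum of the squares of n independent standard normal variables. *)
definition chi_squared :: "nat \<Rightarrow> real measure" where
  "chi_squared n =
     distr (PiM {..<n} (\<lambda>_. std_normal_distribution)) borel (\<lambda>x. \<Sum>i<n. (x i)\<^sup>2)"

(* The measurability conjunct is essential: distr is a junk value at non-measurable maps. *)
definition has_law :: "'w measure \<Rightarrow> ('w \<Rightarrow> real) \<Rightarrow> real measure \<Rightarrow> bool" where
  "has_law M X P \<longleftrightarrow> X \<in> borel_measurable M \<and> distr M borel X = P"

end

(*
  The entries of A form a standard Gaussian vector in the Euclidean space of matrices, and that law
  is invariant under linear isometries. Put u = xtop / |xtop|, let H be the orthogonal complement
  of u in T, and let W be the image of H under the transpose of A. Then y lies in S iff y is
  orthogonal to W and has inner product |xtop| with b = A^T u, so the smallest solution is a multiple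
  of the component of b orthogonal to W, and |xtop|^2 / |y2|^2 = dist(b, W)^2.
  Swapping the "u-row" b of A with a vector g is an isometry of pairs (A, g); hence b may be replaced by
  a Gaussian vector independent of W. Almost surely dim W = dim H = d_e - 1 (by the same swap, since
  proper subspaces are null sets), and the squared distance of a Gaussian vector in R^d to a fixed
  subspace of dimension k is chi-squared with d - k degrees of freedom.
*)
theory Submission
  imports Defs
begin

section \<open>Orthogonal invariance of Lebesgue measure\<close>

text \<open>Two translation-invariant sigma-finite measures \<mu> and \<nu> satisfy
  \<mu>(A) \<nu>(B) = \<mu>(B) \<nu>(A) by Fubini; the unit ball, preserved by an isometry, fixes the constant.\<close>

lemma distr_lborel_orthogonal:
  fixes T :: "'a::euclidean_space \<Rightarrow> 'a"
  assumes "orthogonal_transformation T"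
  shows "distr lborel borel T = lborel"
proof -
  have lin: "linear T"
    using assms orthogonal_transformation_linear by blast
  have T[measurable]: "T \<in> borel_measurable borel"
    by (intro borel_measurable_continuous_onI linear_continuous_on)
       (use lin linear_conv_bounded_linear in blast)
  define \<mu> where "\<mu> = distr lborel borel T"
  have [measurable_cong]: "sets \<mu> = sets borel"
    by (simp add: \<mu>_def)
  have shift: "(\<integral>\<^sup>+x. f (c + x) \<partial>(lborel :: 'a measure)) = (\<integral>\<^sup>+x. f x \<partial>lborel)"
    if [measurable]: "f \<in> borel_measurable borel" for f c
  proof -
    have "(\<integral>\<^sup>+x. f x \<partial>lborel) = (\<integral>\<^sup>+x. f x \<partial>distr lborel borel ((+) c))"
      by (simp add: lborel_distr_plus)
    then show ?thesis
      by (simp add: nn_integral_distr)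
  qed
  have \<mu>_shift: "(\<integral>\<^sup>+x. f (x - c) \<partial>\<mu>) = (\<integral>\<^sup>+x. f x \<partial>\<mu>)"
    if [measurable]: "f \<in> borel_measurable borel" for f c
  proof -
    \<comment> \<open>Translating the image measure by \<open>c\<close> amounts to translating
      Lebesgue measure by a preimage of \<open>c\<close> under the linear surjection
      \<open>T\<close>.\<close>
    obtain c' where c': "c = T c'"
      by (metis assms orthogonal_transformation_surj surjD)
    have "(\<integral>\<^sup>+x. f (x - c) \<partial>\<mu>) = (\<integral>\<^sup>+x. f (T (-c' + x)) \<partial>lborel)"
      by (simp add: \<mu>_def nn_integral_distr c' linear_diff[OF lin])
    also have "\<dots> = (\<integral>\<^sup>+x. f x \<partial>\<mu>)"
      by (subst shift) (simp_all add: \<mu>_def nn_integral_distr)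
    finally show ?thesis .
  qed
  \<comment> \<open>For fixed \<open>x\<close>, the map from y to x - y is a point reflection
    followed by a translation, so it preserves Lebesgue measure. The final integral of the Fubini
    argument has this form.\<close>
  have compl: "(\<integral>\<^sup>+y. indicator A (x - y) \<partial>lborel) = emeasure lborel A"
    if [measurable]: "A \<in> sets borel" for A and x :: 'a
  proof -
    have eq: "(lborel :: 'a measure) = distr lborel borel (\<lambda>y. x - y)"
      using lborel_affine[of "-1" x] by (simp add: density_1)
    have "(\<integral>\<^sup>+y. indicator A (x - y) \<partial>lborel)
        = (\<integral>\<^sup>+y. indicator A y \<partial>distr lborel borel (\<lambda>y. x - y))"
      by (subst nn_integral_distr) auto
    also have "\<dots> = emeasure lborel A"
      unfolding eq[symmetric] by simp
    finally show ?thesis .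
  qed
  have \<mu>_ball: "emeasure \<mu> (ball 0 r) = emeasure lborel (ball (0::'a) r)" for r
  proof -
    have "T -` ball 0 r = ball 0 r"
      using assms by (auto simp: orthogonal_transformation dist_norm)
    then show ?thesis
      by (simp add: \<mu>_def emeasure_distr)
  qed
  have fin: "sigma_finite_measure \<mu>"
  proof -
    show ?thesis
    proof
      show "\<exists>A. countable A \<and> A \<subseteq> sets \<mu> \<and> \<Union>A = space \<mu> \<and> (\<forall>a\<in>A. emeasure \<mu> a \<noteq> \<infinity>)"
      proof (intro exI[of _ "range (\<lambda>n::nat. ball (0::'a) (real n))"] conjI)
        show "\<Union> (range (\<lambda>n::nat. ball (0::'a) (real n))) = space \<mu>"
          using reals_Archimedean2 by (auto simp: \<mu>_def)
        show "\<forall>a\<in>range (\<lambda>n::nat. ball (0::'a) (real n)). emeasure \<mu> a \<noteq> \<infinity>"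
          using emeasure_lborel_ball_finite[of "0::'a"] by (auto simp: \<mu>_ball less_top[symmetric])
      qed (auto simp: \<mu>_def)
    qed
  qed
  interpret P: pair_sigma_finite \<mu> lborel
    by (intro pair_sigma_finite.intro fin lborel.sigma_finite_measure_axioms)
  have key: "emeasure \<mu> A * emeasure lborel B = emeasure \<mu> B * emeasure lborel A"
    if [measurable]: "A \<in> sets borel" "B \<in> sets borel" for A B
  proof -
    have "emeasure \<mu> A * emeasure lborel B = (\<integral>\<^sup>+x. (\<integral>\<^sup>+y. indicator A x * indicator B (x + y) \<partial>lborel) \<partial>\<mu>)"
      by (simp add: nn_integral_cmult shift[of "indicator B"] nn_integral_multc)
    also have "\<dots> = (\<integral>\<^sup>+y. (\<integral>\<^sup>+x. indicator A x * indicator B (x + y) \<partial>\<mu>) \<partial>lborel)"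
      by (rule P.Fubini'[symmetric]) measurable
    \<comment> \<open>Substituting x - y for x is translation invariance of \<open>\<mu>\<close>. It
      frees \<open>B\<close> from \<open>y\<close>, so exchanging the integrals again gives the
      product with \<open>A\<close> and \<open>B\<close> interchanged.\<close>
    also have "\<dots> = (\<integral>\<^sup>+y. (\<integral>\<^sup>+x. indicator A (x - y) * indicator B x \<partial>\<mu>) \<partial>lborel)"
    proof (rule nn_integral_cong)
      fix y :: 'a
      show "(\<integral>\<^sup>+x. indicator A x * indicator B (x + y) \<partial>\<mu>)
          = (\<integral>\<^sup>+x. indicator A (x - y) * indicator B x \<partial>\<mu>)"
        using \<mu>_shift[of "\<lambda>x. indicator A x * indicator B (x + y)" y] by simp
    qed
    also have "\<dots> = (\<integral>\<^sup>+x. (\<integral>\<^sup>+y. indicator A (x - y) * indicator B x \<partial>lborel) \<partial>\<mu>)"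
      by (rule P.Fubini') measurable
    also have "\<dots> = emeasure \<mu> B * emeasure lborel A"
      by (simp add: nn_integral_multc nn_integral_cmult compl mult.commute)
    finally show ?thesis .
  qed
  have "emeasure \<mu> A = emeasure lborel A" if A: "A \<in> sets borel" for A
  proof -
    have nz: "emeasure lborel (ball (0::'a) 1) \<noteq> 0"
      by (simp add: emeasure_ball unit_ball_vol_pos ennreal_eq_0_iff not_le)
    have nt: "emeasure lborel (ball (0::'a) 1) < \<infinity>"
      by (rule emeasure_lborel_ball_finite)
    have "emeasure lborel (ball (0::'a) 1) * emeasure \<mu> A
        = emeasure lborel (ball (0::'a) 1) * emeasure lborel A"
      using key[OF A, of "ball 0 1"] \<mu>_ball[of 1] by (simp add: mult.commute)
    then show ?thesis
      using nz nt by (auto simp: ennreal_mult_cancel_left)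
  qed
  then have "\<mu> = lborel"
    by (intro measure_eqI) (auto simp: \<mu>_def)
  then show ?thesis
    by (simp add: \<mu>_def)
qed

section \<open>Standard Gaussian measures on Euclidean spaces\<close>

definition std_gaussian :: "'a::euclidean_space measure" where
  "std_gaussian = density lborel (\<lambda>x. ennreal (\<Prod>b\<in>Basis. std_normal_density (x \<bullet> b)))"

text \<open>Exposes that the density depends on the norm alone; orthogonal invariance and
  factorization over product spaces both rest on this.\<close>

lemma std_gaussian_density_eq:
  "(\<Prod>b\<in>Basis. std_normal_density (x \<bullet> b))
     = (1 / sqrt (2 * pi)) ^ DIM('a) * exp (- (norm x)\<^sup>2 / 2)" for x :: "'a::euclidean_space"
proof -
  have "(\<Prod>b\<in>Basis. std_normal_density (x \<bullet> b))
      = (\<Prod>b\<in>(Basis :: 'a set). 1 / sqrt (2 * pi)) * (\<Prod>b\<in>Basis. exp (- (x \<bullet> b)\<^sup>2 / 2))"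
    unfolding prod.distrib[symmetric] std_normal_density_def by simp
  also have "(\<Prod>b\<in>Basis. exp (- (x \<bullet> b)\<^sup>2 / 2)) = exp (\<Sum>b\<in>Basis. - (x \<bullet> b)\<^sup>2 / 2)"
    by (simp add: exp_sum)
  also have "(\<Sum>b\<in>Basis. - (x \<bullet> b)\<^sup>2 / 2) = - (norm x)\<^sup>2 / 2"
    by (simp add: norm_eq_sqrt_inner euclidean_inner[of x x] power2_eq_square sum_negf sum_divide_distrib
        sum_nonneg)
  finally show ?thesis by simp
qed

lemma sets_std_gaussian [simp, measurable_cong]: "sets std_gaussian = sets borel"
  and space_std_gaussian [simp]: "space std_gaussian = UNIV"
  by (simp_all add: std_gaussian_def)

text \<open>Lebesgue measure is the image of the product of one-dimensional Lebesgue measures under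
  the basis expansion, and the product density passes through this image.\<close>

lemma std_gaussian_eq_PiM:
  "(std_gaussian :: 'a::euclidean_space measure) =
     distr (PiM Basis (\<lambda>_. std_normal_distribution)) borel (\<lambda>x. \<Sum>b\<in>Basis. x b *\<^sub>R b)"
proof -
  let ?F = "\<lambda>x::'a \<Rightarrow> real. \<Sum>b\<in>Basis. x b *\<^sub>R b"
  interpret P: product_sigma_finite "\<lambda>_::'a. lborel :: real measure" ..
  interpret N: product_sigma_finite "\<lambda>_::'a. std_normal_distribution"
    by (intro product_sigma_finite.intro prob_space_imp_sigma_finite prob_space_normal_density) simp
  \<comment> \<open>Checked on boxes, where the integral of the product density splits into
    one-dimensional factors.\<close>
  have PiM: "density (PiM Basis (\<lambda>_. lborel)) (\<lambda>x. ennreal (\<Prod>b\<in>Basis. std_normal_density (x b)))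
      = PiM (Basis :: 'a set) (\<lambda>_. std_normal_distribution)"
  proof (rule N.PiM_eqI)
    show "sets (density (PiM Basis (\<lambda>_. lborel)) (\<lambda>x. ennreal (\<Prod>b\<in>Basis. std_normal_density (x b))))
        = sets (PiM (Basis :: 'a set) (\<lambda>_. std_normal_distribution))"
      unfolding sets_density by (intro sets_PiM_cong) auto
    fix A assume A: "\<And>i::'a. i \<in> Basis \<Longrightarrow> A i \<in> sets std_normal_distribution"
    have [measurable]: "Pi\<^sub>E Basis A \<in> sets (PiM Basis (\<lambda>_. lborel))"
      using A by (intro sets_PiM_I_finite) auto
    have "emeasure (density (PiM Basis (\<lambda>_. lborel)) (\<lambda>x. ennreal (\<Prod>b\<in>Basis. std_normal_density (x b)))) (Pi\<^sub>E Basis A)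
        = (\<integral>\<^sup>+x. ennreal (\<Prod>b\<in>Basis. std_normal_density (x b)) * indicator (Pi\<^sub>E Basis A) x \<partial>PiM Basis (\<lambda>_. lborel))"
      by (subst emeasure_density) auto
    also have "\<dots> = (\<integral>\<^sup>+x. (\<Prod>b\<in>Basis. ennreal (std_normal_density (x b)) * indicator (A b) (x b)) \<partial>PiM Basis (\<lambda>_. lborel))"
    proof (intro nn_integral_cong)
      fix x :: "'a \<Rightarrow> real" assume x: "x \<in> space (PiM Basis (\<lambda>_. lborel))"
      have "indicator (Pi\<^sub>E Basis A) x = (\<Prod>b\<in>Basis. indicator (A b) (x b) :: ennreal)"
        using x by (auto simp: indicator_def PiE_iff space_PiM prod_zero_iff)
      then show "ennreal (\<Prod>b\<in>Basis. std_normal_density (x b)) * indicator (Pi\<^sub>E Basis A) x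
          = (\<Prod>b\<in>Basis. ennreal (std_normal_density (x b)) * indicator (A b) (x b))"
        by (simp add: prod.distrib prod_ennreal)
    qed
    also have "\<dots> = (\<Prod>b\<in>Basis. \<integral>\<^sup>+x. ennreal (std_normal_density x) * indicator (A b) x \<partial>lborel)"
      using A by (intro P.product_nn_integral_prod) auto
    also have "\<dots> = (\<Prod>b\<in>Basis. emeasure std_normal_distribution (A b))"
      using A by (intro prod.cong refl) (auto simp: emeasure_density)
    finally show "emeasure (density (PiM Basis (\<lambda>_. lborel)) (\<lambda>x. ennreal (\<Prod>b\<in>Basis. std_normal_density (x b)))) (Pi\<^sub>E Basis A)
        = (\<Prod>b\<in>Basis. emeasure std_normal_distribution (A b))" .
  qed simp
  have "std_gaussian = density (distr (PiM Basis (\<lambda>_. lborel)) borel ?F)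
      (\<lambda>x. ennreal (\<Prod>b\<in>Basis. std_normal_density (x \<bullet> b)))"
    unfolding std_gaussian_def by (subst lborel_eq) simp
  also have "\<dots> = distr (density (PiM Basis (\<lambda>_. lborel)) (\<lambda>x. ennreal (\<Prod>b\<in>Basis. std_normal_density (?F x \<bullet> b)))) borel ?F"
    by (subst density_distr) auto
  also have "(\<lambda>x. ennreal (\<Prod>b\<in>Basis. std_normal_density (?F x \<bullet> b)))
      = (\<lambda>x. ennreal (\<Prod>b\<in>Basis. std_normal_density (x b)))"
    by simp
  finally show ?thesis
    unfolding PiM .
qed

lemma prob_space_std_gaussian: "prob_space (std_gaussian :: 'a::euclidean_space measure)"
  unfolding std_gaussian_eq_PiM
  by (intro prob_space.prob_space_distr prob_space_PiM prob_space_normal_density) auto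

text \<open>The density is invariant because \<open>T\<close> preserves norms, and Lebesgue measure
  by \<open>distr_lborel_orthogonal\<close>.\<close>

lemma distr_std_gaussian_orthogonal:
  fixes T :: "'a::euclidean_space \<Rightarrow> 'a"
  assumes "orthogonal_transformation T"
  shows "distr std_gaussian borel T = std_gaussian"
proof -
  have T[measurable]: "T \<in> borel_measurable borel"
    using assms orthogonal_transformation_linear[OF assms]
    by (intro borel_measurable_continuous_onI linear_continuous_on)
       (simp add: linear_conv_bounded_linear)
  have "distr std_gaussian borel T
      = distr (density lborel ((\<lambda>x. ennreal (\<Prod>b\<in>Basis. std_normal_density (x \<bullet> b))) \<circ> T)) borel T"
    using assms unfolding std_gaussian_def
    by (simp add: std_gaussian_density_eq orthogonal_transformation comp_def)
  also have "\<dots> = density (distr lborel borel T) (\<lambda>x. ennreal (\<Prod>b\<in>Basis. std_normal_density (x \<bullet> b)))"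
    by (subst density_distr) (auto simp: comp_def)
  finally show ?thesis
    using assms by (simp add: distr_lborel_orthogonal std_gaussian_def)
qed

text \<open>Squared norms of pairs add, so the exponentials multiply. Isometries of a product space
  can thus be applied to independent vectors.\<close>

lemma std_gaussian_prod:
  "(std_gaussian :: ('a::euclidean_space \<times> 'b::euclidean_space) measure) = std_gaussian \<Otimes>\<^sub>M std_gaussian"
proof -
  have "(std_gaussian :: 'a measure) \<Otimes>\<^sub>M (std_gaussian :: 'b measure) = density (lborel \<Otimes>\<^sub>M lborel)
     (\<lambda>(x,y). ennreal (\<Prod>b\<in>Basis. std_normal_density (x \<bullet> b)) * ennreal (\<Prod>b\<in>Basis. std_normal_density (y \<bullet> b)))"
    using prob_space_std_gaussian[where 'a='b] unfolding std_gaussian_def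
    by (intro pair_measure_density) (auto intro: prob_space_imp_sigma_finite lborel.sigma_finite_measure_axioms)
  also have "(\<lambda>(x,y). ennreal (\<Prod>b\<in>Basis. std_normal_density (x \<bullet> b)) * ennreal (\<Prod>b\<in>Basis. std_normal_density (y \<bullet> b)))
      = (\<lambda>z::'a \<times> 'b. ennreal (\<Prod>b\<in>Basis. std_normal_density (z \<bullet> b)))"
    by (auto simp: fun_eq_iff std_gaussian_density_eq ennreal_mult[symmetric] power_add norm_Pair
        exp_add[symmetric] add_divide_distrib mult_ac)
  also have "density (lborel \<Otimes>\<^sub>M lborel) \<dots> = std_gaussian"
    unfolding std_gaussian_def lborel_prod ..
  finally show ?thesis by simp
qed

text \<open>A proper subspace lies in a hyperplane, which is a Lebesgue null set.\<close>

lemma AE_std_gaussian_notin_subspace: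
  fixes W :: "'a::euclidean_space set"
  assumes "dim W < DIM('a)"
  shows "AE g in std_gaussian. g \<notin> span W"
proof -
  obtain a where a: "a \<noteq> 0" "span W \<subseteq> {x. a \<bullet> x = 0}"
    using lowdim_subset_hyperplane[OF assms] by metis
  have "AE g in lborel. g \<notin> {x. a \<bullet> x = 0}"
  proof (rule AE_not_in)
    have "negligible {x. a \<bullet> x = 0}"
      using a by (intro negligible_hyperplane) auto
    then have "{x. a \<bullet> x = 0} \<in> null_sets lebesgue"
      by (simp add: negligible_iff_null_sets)
    moreover have "{x. a \<bullet> x = 0} \<in> sets borel"
      by (intro borel_closed closed_hyperplane)
    ultimately show "{x. a \<bullet> x = 0} \<in> null_sets lborel"
      by (simp add: null_sets_def emeasure_completion)
  qed
  then show ?thesis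
    using a unfolding std_gaussian_def by (subst AE_density) (auto elim!: eventually_mono)
qed

section \<open>Exchanging one row component of a Gaussian matrix\<close>

text \<open>The rank-one matrix u g^T.\<close>

definition outer :: "real ^ 'n \<Rightarrow> real ^ 'm \<Rightarrow> real ^ 'm ^ 'n" where
  "outer u g = (\<chi> i. u $ i *\<^sub>R g)"

text \<open>For the entrywise inner product, \<open>outer u\<close> is the adjoint of the map from
  \<open>A\<close> to \<open>u v* A\<close>; this evaluates the cross term in the norm of an updated
  matrix.\<close>

lemma inner_outer: "outer u g \<bullet> A = g \<bullet> (u v* A)"
proof -
  have "outer u g \<bullet> A = (\<Sum>i\<in>UNIV. \<Sum>j\<in>UNIV. u $ i * g $ j * A $ i $ j)"
    by (simp add: outer_def inner_vec_def)
  also have "\<dots> = (\<Sum>j\<in>UNIV. \<Sum>i\<in>UNIV. u $ i * g $ j * A $ i $ j)"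
    by (rule sum.swap)
  also have "\<dots> = g \<bullet> (u v* A)"
    by (simp add: inner_vec_def vector_matrix_mult_def sum_distrib_left mult_ac)
  finally show ?thesis .
qed

lemma vector_matrix_mult_outer: "v v* outer u g = (v \<bullet> u) *\<^sub>R g"
  by (simp add: vec_eq_iff outer_def vector_matrix_mult_def inner_vec_def sum_distrib_left mult_ac)

lemma linear_vector_matrix_mult: "linear (\<lambda>u::real^'n. u v* A)"
  by (intro linearI) (simp_all add: vector_matrix_left_distrib scaleR_vector_matrix_assoc)

text \<open>Meaningful for unit vectors u only: then the component u v* A of A along u becomes g.\<close>

definition replace_row :: "real ^ 'D \<Rightarrow> real ^ 'd ^ 'D \<Rightarrow> real ^ 'd \<Rightarrow> real ^ 'd ^ 'D" where
  "replace_row u A g = A + outer u (g - u v* A)"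

lemma vector_matrix_mult_replace_row:
  "v v* replace_row u A g = v v* A + (v \<bullet> u) *\<^sub>R (g - u v* A)"
  by (simp add: replace_row_def vector_matrix_mult_add_rdistrib vector_matrix_mult_outer)

lemma continuous_vector_matrix_mult [continuous_intros]:
  "continuous_on S f \<Longrightarrow> continuous_on S (\<lambda>x. u v* (f x :: real ^ 'd ^ 'D))"
  unfolding vector_matrix_mult_def by (intro continuous_intros)

lemma continuous_outer [continuous_intros]:
  "continuous_on S f \<Longrightarrow> continuous_on S (\<lambda>x. outer u (f x))"
  unfolding outer_def by (intro continuous_intros)

lemma measurable_replace_row [measurable]:
  "(\<lambda>(A, g). replace_row u A g) \<in> borel_measurable (borel \<Otimes>\<^sub>M borel)"
  unfolding borel_prod replace_row_def case_prod_beta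
  by (intro borel_measurable_continuous_onI continuous_intros)

text \<open>Exchanging \<open>g\<close> with the component of \<open>A\<close> along
  \<open>u\<close> is a linear isometry of pairs, so it preserves the Gaussian law of the pair; the
  claim is its first marginal.\<close>

lemma distr_replace_row:
  fixes u :: "real ^ 'D"
  assumes u: "norm u = 1"
  shows "distr (std_gaussian \<Otimes>\<^sub>M std_gaussian) borel (\<lambda>(A, g). replace_row u A g)
    = (std_gaussian :: (real ^ 'd ^ 'D) measure)"
proof -
  \<comment> \<open>Keeping the displaced component \<open>u v* A\<close> in second place makes the
    map norm preserving.\<close>
  define R where "R = (\<lambda>(A :: real ^ 'd ^ 'D, g). (replace_row u A g, u v* A))"
  have R_lin: "linear R"
    unfolding R_def
    by (intro linearI)
       (auto simp: replace_row_def outer_def vec_eq_iff vector_matrix_mult_add_rdistrib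
        scaleR_vector_matrix_assoc algebra_simps vector_matrix_mult_def sum_distrib_left sum.distrib)
  have R_norm: "norm (R z) = norm z" for z
  proof (cases z)
    case (Pair A g)
    define b where "b = u v* A"
    \<comment> \<open>As \<open>u\<close> is a unit vector, \<open>outer u\<close> preserves norms,
      and \<open>inner_outer\<close> gives the cross term.\<close>
    have "(norm (replace_row u A g))\<^sup>2 = (norm A)\<^sup>2 + 2 * ((g - b) \<bullet> b) + (norm (g - b))\<^sup>2"
      using u by (simp add: replace_row_def b_def[symmetric] power2_norm_eq_inner inner_add_left
          inner_add_right inner_commute[of A "outer u (g - b)"] inner_outer vector_matrix_mult_outer norm_eq_1)
    also have "\<dots> = (norm A)\<^sup>2 + (norm g)\<^sup>2 - (norm b)\<^sup>2"
      by (simp add: power2_norm_eq_inner inner_diff_left inner_diff_right inner_commute)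
    finally have "(norm (R z))\<^sup>2 = (norm z)\<^sup>2"
      by (simp add: R_def Pair norm_Pair b_def)
    then show ?thesis by simp
  qed
  have R: "orthogonal_transformation R"
    using R_lin R_norm by (simp add: orthogonal_transformation)
  have R_meas: "R \<in> borel_measurable borel"
    using R_lin by (intro borel_measurable_continuous_onI linear_continuous_on)
       (simp add: linear_conv_bounded_linear)
  interpret P: prob_space "std_gaussian :: (real ^ 'd) measure"
    by (rule prob_space_std_gaussian)
  have fst_meas: "fst \<in> borel_measurable (borel :: ((real ^ 'd ^ 'D) \<times> (real ^ 'd)) measure)"
    by (intro borel_measurable_continuous_onI continuous_intros)
  have "distr std_gaussian borel (\<lambda>(A, g). replace_row u A g)
      = distr std_gaussian borel (fst \<circ> R)"
    by (rule distr_cong) (auto simp: R_def)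
  also have "\<dots> = distr (distr std_gaussian borel R) borel fst"
    using R_meas fst_meas by (subst distr_distr) auto
  also have "\<dots> = distr (std_gaussian \<Otimes>\<^sub>M (std_gaussian :: (real ^ 'd) measure)) borel fst"
    by (simp add: distr_std_gaussian_orthogonal[OF R] std_gaussian_prod[symmetric])
  also have "\<dots> = distr (std_gaussian \<Otimes>\<^sub>M (std_gaussian :: (real ^ 'd) measure)) std_gaussian fst"
    by (intro distr_cong) auto
  also have "\<dots> = std_gaussian"
    by (rule P.distr_pair_fst)
  finally show ?thesis
    by (simp add: std_gaussian_prod)
qed

section \<open>Distance from one row component to the image of a subspace\<close>

text \<open>Its square is almost surely the ratio in the theorem, when \<open>u\<close> is the
  direction of \<open>xtop\<close> and \<open>H\<close> the orthogonal complement of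
  \<open>u\<close> in \<open>T\<close>.\<close>

definition row_dist :: "real ^ 'D \<Rightarrow> (real ^ 'D) set \<Rightarrow> real ^ 'd ^ 'D \<Rightarrow> real" where
  "row_dist u H A = infdist (u v* A) ((\<lambda>v. v v* A) ` H)"

text \<open>The infimum may run over an uncountable \<open>H\<close>, but its strict sublevel sets
  are unions of open sets.\<close>

lemma measurable_row_dist [measurable]: "row_dist u H \<in> borel_measurable borel"
proof (cases "H = {}")
  case True
  then show ?thesis by (simp add: row_dist_def[abs_def] infdist_def)
next
  case False
  show ?thesis
  proof (rule borel_measurableI_less)
    fix a
    have "{A. row_dist u H A < a} = (\<Union>v\<in>H. {A. dist (u v* A) (v v* A) < a})"
      using False
      by (auto simp: row_dist_def infdist_notempty image_image cINF_less_iff bdd_below.I2[of _ 0])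
    moreover have "open \<dots>"
      by (intro open_UN ballI open_Collect_less continuous_intros)
    ultimately show "{A \<in> space borel. row_dist u H A < a} \<in> sets borel"
      by (metis (no_types, lifting) borel_open Collect_cong UNIV_I space_borel)
  qed
qed

text \<open>Replace the component along \<open>u\<close> by an independent Gaussian
  \<open>g\<close>. The image of \<open>H\<close> does not move, as \<open>H\<close> is orthogonal
  to \<open>u\<close>, and it is a proper subspace, which \<open>g\<close> almost surely
  misses.\<close>

lemma AE_row_notin_span:
  fixes H :: "(real ^ 'D) set"
  assumes u: "norm u = 1" and uH: "\<And>v. v \<in> H \<Longrightarrow> v \<bullet> u = 0" and H: "subspace H" "dim H < CARD('d)"
  shows "AE A :: real ^ 'd ^ 'D in std_gaussian. u v* A \<notin> (\<lambda>v. v v* A) ` H"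
proof -
  interpret P: pair_prob_space "std_gaussian :: (real ^ 'd ^ 'D) measure" "std_gaussian :: (real ^ 'd) measure"
    by (intro pair_prob_space.intro pair_sigma_finite.intro prob_space_std_gaussian
        prob_space_imp_sigma_finite)
  have sub: "subspace ((\<lambda>v. v v* A) ` H)" for A :: "real ^ 'd ^ 'D"
    by (intro linear_subspace_image linear_vector_matrix_mult H)
  \<comment> \<open>Subspaces are closed, so membership means distance zero; in this form the event
    is measurable by \<open>measurable_row_dist\<close>.\<close>
  have iff: "u v* A \<notin> (\<lambda>v. v v* A) ` H \<longleftrightarrow> row_dist u H A \<noteq> 0" for A :: "real ^ 'd ^ 'D"
    unfolding row_dist_def using closed_subspace[OF sub] subspace_0[OF H(1)]
    by (subst in_closed_iff_infdist_zero) auto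
  have row: "u v* replace_row u A g = g" for A and g :: "real ^ 'd"
    using u by (simp add: vector_matrix_mult_replace_row norm_eq_1)
  have rows: "(\<lambda>v. v v* replace_row u A g) ` H = (\<lambda>v. v v* A) ` H" for A and g :: "real ^ 'd"
    using uH by (intro image_cong) (auto simp: vector_matrix_mult_replace_row)
  have "AE z in std_gaussian \<Otimes>\<^sub>M std_gaussian. row_dist u H (case z of (A, g :: real ^ 'd) \<Rightarrow> replace_row u A g) \<noteq> 0"
  proof (rule P.AE_pair_measure)
    show "{z \<in> space (std_gaussian \<Otimes>\<^sub>M std_gaussian). row_dist u H (case z of (A, g :: real ^ 'd) \<Rightarrow> replace_row u A g) \<noteq> 0}
        \<in> sets (std_gaussian \<Otimes>\<^sub>M std_gaussian)"
      by measurable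
    show "AE A in std_gaussian. AE g :: real ^ 'd in std_gaussian. row_dist u H (case (A, g) of (A, g) \<Rightarrow> replace_row u A g) \<noteq> 0"
    proof (rule AE_I2)
      fix A :: "real ^ 'd ^ 'D"
      have "dim ((\<lambda>v. v v* A) ` H) \<le> dim H"
        by (rule dim_image_le) (rule linear_vector_matrix_mult)
      then have "AE g in std_gaussian. g \<notin> span ((\<lambda>v. v v* A) ` H)"
        using H by (intro AE_std_gaussian_notin_subspace) auto
      then show "AE g :: real ^ 'd in std_gaussian. row_dist u H (case (A, g) of (A, g) \<Rightarrow> replace_row u A g) \<noteq> 0"
        by (rule eventually_mono) (simp add: iff[symmetric] row rows span_eq_iff[THEN iffD2, OF sub])
    qed
  qed
  then have "AE A in distr (std_gaussian \<Otimes>\<^sub>M std_gaussian) borel (\<lambda>(A, g :: real ^ 'd). replace_row u A g). row_dist u H A \<noteq> 0"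
    by (subst AE_distr_iff) auto
  then show ?thesis
    unfolding distr_replace_row[OF u] iff .
qed

text \<open>Vectors are added one at a time: each is orthogonal to the span of the earlier ones, so
  its image almost surely leaves theirs and raises the dimension by one.\<close>

lemma AE_dim_rows:
  fixes C :: "(real ^ 'D) set"
  assumes "finite C" "pairwise orthogonal C" "\<And>u. u \<in> C \<Longrightarrow> norm u = 1" "card C \<le> CARD('d)"
  shows "AE A :: real ^ 'd ^ 'D in std_gaussian. dim ((\<lambda>v. v v* A) ` span C) = card C"
  using assms
proof (induction C rule: finite_induct)
  case empty
  then show ?case by simp
next
  case (insert u C)
  have orth: "v \<bullet> u = 0" if "v \<in> span C" for v
  proof -
    have "orthogonal u v"
      by (rule orthogonal_to_span[OF that])
        (use insert.hyps insert.prems(1) in \<open>auto simp: pairwise_insert\<close>)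
    then show ?thesis
      by (simp add: orthogonal_def inner_commute)
  qed
  have IH: "AE A :: real ^ 'd ^ 'D in std_gaussian. dim ((\<lambda>v. v v* A) ` span C) = card C"
    using insert by (intro insert.IH) (auto simp: pairwise_insert)
  \<comment> \<open>Strict, because the cardinality bound also counts the new vector
    \<open>u\<close>.\<close>
  have "dim (span C) < CARD('d)"
    using dim_le_card'[OF insert.hyps(1)] insert.prems insert.hyps by simp
  then have "AE A :: real ^ 'd ^ 'D in std_gaussian. u v* A \<notin> (\<lambda>v. v v* A) ` span C"
    using insert.prems orth by (intro AE_row_notin_span) auto
  with IH show ?case
  proof eventually_elim
    case (elim A)
    have im: "(\<lambda>v. v v* A) ` span D = span ((\<lambda>v. v v* A) ` D)" for D
      by (rule linear_span_image[symmetric]) (rule linear_vector_matrix_mult)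
    show ?case
      using elim insert.hyps by (simp add: im dim_insert)
  qed
qed

section \<open>Chi-squared law of the squared distance to a fixed subspace\<close>

text \<open>The hypotheses make \<open>w\<close> the orthogonal projection of \<open>x\<close>;
  Pythagoras shows that no point of \<open>W\<close> is closer.\<close>

lemma infdist_subspace:
  fixes W :: "'a::euclidean_space set"
  assumes "w \<in> W" "\<And>v. v \<in> W \<Longrightarrow> (x - w) \<bullet> v = 0" "subspace W"
  shows "infdist x W = norm (x - w)"
proof (rule antisym)
  show "infdist x W \<le> norm (x - w)"
    using infdist_le[OF assms(1), of x] by (simp add: dist_norm)
  show "norm (x - w) \<le> infdist x W"
    unfolding infdist_notempty[OF ex_in_conv[THEN iffD1, OF exI, OF assms(1)]]
  proof (rule cINF_greatest)
    fix v assume "v \<in> W"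
    then have "(x - w) \<bullet> (w - v) = 0"
      using assms by (simp add: subspace_diff)
    then have "(norm (x - v))\<^sup>2 = (norm (x - w))\<^sup>2 + (norm (w - v))\<^sup>2"
      using norm_add_Pythagorean[of "x - w" "w - v"] by (simp add: orthogonal_def)
    then show "norm (x - w) \<le> dist x v"
      by (metis dist_norm le_add_same_cancel1 norm_ge_zero power2_le_imp_le zero_le_power2)
  qed (use assms in auto)
qed

text \<open>A rotation carries a coordinate subspace to \<open>W\<close>. The squared distance then
  becomes the sum of squares of the remaining coordinates, which are independent standard
  normals.\<close>

lemma distr_std_gaussian_infdist:
  fixes W :: "'a::euclidean_space set"
  assumes W: "subspace W"
  shows "distr std_gaussian borel (\<lambda>g. (infdist g W)\<^sup>2) = chi_squared (DIM('a) - dim W)"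
proof -
  define V where "V = {y. \<forall>x\<in>W. orthogonal x y}"
  have V: "subspace V"
    unfolding V_def by (rule subspace_orthogonal_to_vectors)
  have dimV: "dim V + dim W = DIM('a)"
    using dim_subspace_orthogonal_to_vectors[OF W subspace_UNIV] by (simp add: V_def)
  obtain B where B: "B \<subseteq> W" "pairwise orthogonal B" "\<And>x. x \<in> B \<Longrightarrow> norm x = 1"
      "independent B" "card B = dim W" "span B = W"
    using orthonormal_basis_subspace[OF W] by metis
  obtain C where C: "C \<subseteq> V" "pairwise orthogonal C" "\<And>x. x \<in> C \<Longrightarrow> norm x = 1"
      "independent C" "card C = dim V" "span C = V"
    using orthonormal_basis_subspace[OF V] by metis
  have fin: "finite B" "finite C"
    using B C independent_imp_finite by auto
  have BC: "b \<bullet> c = 0" if "b \<in> B" "c \<in> C" for b c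
    using that B(1) C(1) by (auto simp: V_def orthogonal_def)
  have CB: "c \<bullet> b = 0" if "b \<in> B" "c \<in> C" for b c
    using BC[OF that] by (simp add: inner_commute)
  have disj: "B \<inter> C = {}"
    using BC B(3) by (metis disjoint_iff inner_eq_zero_iff norm_zero zero_neq_one)
  have card: "card (B \<union> C) = DIM('a)"
    using B C fin disj dimV by (simp add: card_Un_disjoint)
  have ip: "x \<bullet> y = (if x = y then 1 else 0)" if "x \<in> B \<union> C" "y \<in> B \<union> C" for x y
    using that B(2,3) C(2,3) BC CB
    by (auto simp: pairwise_def orthogonal_def norm_eq_1)
  obtain \<phi> where \<phi>: "bij_betw \<phi> (Basis :: 'a set) (B \<union> C)"
    using card fin finite_same_card_bij[OF finite_Basis, of "B \<union> C"] by auto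
  have \<phi>_in: "\<phi> b \<in> B \<union> C" if "b \<in> Basis" for b
    using \<phi> that by (auto simp: bij_betw_def)
  have \<phi>_inj: "\<phi> b = \<phi> c \<longleftrightarrow> b = c" if "b \<in> Basis" "c \<in> Basis" for b c
    using \<phi> that by (auto simp: bij_betw_def inj_on_def)
  have ip_\<phi>: "\<phi> b \<bullet> \<phi> c = (if b = c then 1 else 0)" if "b \<in> Basis" "c \<in> Basis" for b c
    using ip[OF \<phi>_in[OF that(1)] \<phi>_in[OF that(2)]] \<phi>_inj[OF that] by simp
  \<comment> \<open>The orthogonal map taking the standard basis to the orthonormal basis
    \<open>B \<union> C\<close>, adapted to the splitting into \<open>W\<close> and its complement
    \<open>V\<close>.\<close>
  define Q where "Q = (\<lambda>x. \<Sum>b\<in>Basis. (x \<bullet> b) *\<^sub>R \<phi> b)"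
  have Q: "orthogonal_transformation Q"
    unfolding orthogonal_transformation_def
  proof (intro conjI allI)
    show "linear Q"
      unfolding Q_def
      by (intro linearI) (simp_all add: inner_add_left scaleR_left_distrib sum.distrib scaleR_sum_right)
    fix v w
    have "Q v \<bullet> Q w = (\<Sum>b\<in>Basis. \<Sum>c\<in>Basis. (v \<bullet> b) * (w \<bullet> c) * (if b = c then 1 else 0))"
      unfolding Q_def inner_sum_left inner_sum_right
      by (subst sum.swap, intro sum.cong refl) (auto simp: ip_\<phi>)
    then show "Q v \<bullet> Q w = v \<bullet> w"
      by (simp add: euclidean_inner[of v w] if_distrib[of "\<lambda>x. _ * x"] cong: if_cong)
  qed
  \<comment> \<open>The standard directions that \<open>Q\<close> sends into \<open>V\<close>; only
    these contribute to the distance from \<open>W\<close>.\<close>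
  define J where "J = {b \<in> Basis. \<phi> b \<in> C}"
  have J: "bij_betw \<phi> J C"
    unfolding bij_betw_def
  proof
    show "inj_on \<phi> J"
      using \<phi>_inj by (auto simp: J_def inj_on_def)
    show "\<phi> ` J = C"
      using \<phi> by (force simp: J_def bij_betw_def)
  qed
  have cardJ: "card J = DIM('a) - dim W"
    using bij_betw_same_card[OF J] C dimV by simp
  have finJ: "finite J" and JB: "J \<subseteq> Basis"
    by (auto simp: J_def)
  obtain e where e: "bij_betw e {..<DIM('a) - dim W} J"
    using finite_same_card_bij[of "{..<DIM('a) - dim W}" J] cardJ finJ by auto
  have dist_Q: "(infdist (Q x) W)\<^sup>2 = (\<Sum>b\<in>J. (x \<bullet> b)\<^sup>2)" for x
  proof -
    define p where "p = (\<Sum>b\<in>J. (x \<bullet> b) *\<^sub>R \<phi> b)"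
    define w where "w = (\<Sum>b\<in>Basis - J. (x \<bullet> b) *\<^sub>R \<phi> b)"
    have Qx: "Q x = w + p"
      unfolding Q_def w_def p_def using JB by (simp add: sum.subset_diff)
    have "w \<in> W"
      unfolding w_def using \<phi>_in B(1)
      by (intro subspace_sum W subspace_scale) (auto simp: J_def)
    moreover have "p \<in> V"
      unfolding p_def using C(1)
      by (intro subspace_sum V subspace_scale) (auto simp: J_def)
    ultimately have "infdist (Q x) W = norm p"
      using infdist_subspace[of w W "Q x"] W Qx by (simp add: V_def orthogonal_def inner_commute)
    also have "(norm p)\<^sup>2 = (\<Sum>b\<in>J. (x \<bullet> b)\<^sup>2)"
    proof -
      have "(norm p)\<^sup>2 = (\<Sum>b\<in>J. \<Sum>c\<in>J. (x \<bullet> b) * (x \<bullet> c) * (if b = c then 1 else 0))"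
        unfolding power2_norm_eq_inner p_def inner_sum_left inner_sum_right
        using JB by (intro sum.cong refl) (auto simp: ip_\<phi> subset_iff)
      then show ?thesis
        using finJ by (simp add: if_distrib[of "\<lambda>x. _ * x"] power2_eq_square cong: if_cong)
    qed
    finally show ?thesis .
  qed
  have inf_meas: "(\<lambda>g::'a. (infdist g W)\<^sup>2) \<in> borel_measurable borel"
    by (intro borel_measurable_continuous_onI continuous_intros)
  have Q_meas: "Q \<in> borel_measurable borel"
    using orthogonal_transformation_linear[OF Q]
    by (intro borel_measurable_continuous_onI linear_continuous_on) (simp add: linear_conv_bounded_linear)
  let ?N = "\<lambda>_. std_normal_distribution" and ?k = "DIM('a) - dim W"
  let ?S = "\<lambda>x::'a \<Rightarrow> real. \<Sum>b\<in>Basis. x b *\<^sub>R b"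
  have "distr std_gaussian borel (\<lambda>g. (infdist g W)\<^sup>2)
      = distr (distr std_gaussian borel Q) borel (\<lambda>g. (infdist g W)\<^sup>2)"
    by (simp add: distr_std_gaussian_orthogonal[OF Q])
  also have "\<dots> = distr std_gaussian borel (\<lambda>x. \<Sum>b\<in>J. (x \<bullet> b)\<^sup>2)"
    using Q_meas inf_meas by (subst distr_distr) (auto simp: comp_def dist_Q)
  also have "\<dots> = distr (PiM Basis ?N) borel (\<lambda>x. \<Sum>b\<in>J. (?S x \<bullet> b)\<^sup>2)"
    unfolding std_gaussian_eq_PiM by (subst distr_distr) (auto simp: comp_def)
  \<comment> \<open>Relabels the coordinates in \<open>J\<close> by the index set of
    \<open>chi_squared\<close>; the restriction gives a map into the product space over that set,
    the form \<open>distr_PiM_reindex\<close> needs.\<close>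
  also have "\<dots> = distr (PiM Basis ?N) borel (\<lambda>x. \<Sum>i<?k. ((\<lambda>n\<in>{..<?k}. x (e n)) i)\<^sup>2)"
  proof (rule distr_cong)
    fix x
    have "(\<Sum>b\<in>J. (?S x \<bullet> b)\<^sup>2) = (\<Sum>b\<in>J. (x b)\<^sup>2)"
      using JB by (intro sum.cong) auto
    also have "\<dots> = (\<Sum>i<?k. (x (e i))\<^sup>2)"
      using sum.reindex_bij_betw[OF e, of "\<lambda>b. (x b)\<^sup>2"] by simp
    finally show "(\<Sum>b\<in>J. (?S x \<bullet> b)\<^sup>2) = (\<Sum>i<?k. ((\<lambda>n\<in>{..<?k}. x (e n)) i)\<^sup>2)"
      by simp
  qed auto
  also have "\<dots> = distr (distr (PiM Basis ?N) (PiM {..<?k} ?N) (\<lambda>x. \<lambda>n\<in>{..<?k}. x (e n))) borel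
      (\<lambda>x. \<Sum>i<?k. (x i)\<^sup>2)"
    using e JB by (subst distr_distr) (auto simp: comp_def bij_betw_def intro!: measurable_restrict measurable_component_singleton)
  also have "\<dots> = chi_squared ?k"
    unfolding chi_squared_def using e JB
    by (subst distr_PiM_reindex) (auto simp: bij_betw_def intro!: prob_space_normal_density)
  finally show ?thesis .
qed

text \<open>After the exchange with \<open>g\<close>, Fubini fixes \<open>A\<close> and leaves the
  distance from \<open>g\<close> to a fixed subspace. Its law is the same for almost every
  \<open>A\<close>, so averaging over \<open>A\<close> preserves it.\<close>

lemma distr_row_dist:
  fixes u :: "real ^ 'D"
  assumes u: "norm u = 1" and uH: "\<And>v. v \<in> H \<Longrightarrow> v \<bullet> u = 0"
    and H: "subspace H" "dim H \<le> CARD('d)"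
  shows "distr std_gaussian borel (\<lambda>A :: real ^ 'd ^ 'D. (row_dist u H A)\<^sup>2)
    = chi_squared (CARD('d) - dim H)"
proof (rule measure_eqI)
  interpret P: pair_prob_space "std_gaussian :: (real ^ 'd ^ 'D) measure" "std_gaussian :: (real ^ 'd) measure"
    by (intro pair_prob_space.intro pair_sigma_finite.intro prob_space_std_gaussian
        prob_space_imp_sigma_finite)
  show "sets (distr std_gaussian borel (\<lambda>A :: real ^ 'd ^ 'D. (row_dist u H A)\<^sup>2))
      = sets (chi_squared (CARD('d) - dim H))"
    by (simp add: chi_squared_def)
  fix E assume "E \<in> sets (distr std_gaussian borel (\<lambda>A :: real ^ 'd ^ 'D. (row_dist u H A)\<^sup>2))"
  then have E [measurable]: "E \<in> sets borel" by simp
  let ?W = "\<lambda>A :: real ^ 'd ^ 'D. (\<lambda>v. v v* A) ` H"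
  have sub: "subspace (?W A)" for A
    by (intro linear_subspace_image linear_vector_matrix_mult H)
  have row: "row_dist u H (replace_row u A g) = infdist g (?W A)" for A and g :: "real ^ 'd"
  proof -
    have "?W (replace_row u A g) = ?W A"
      using uH by (intro image_cong) (auto simp: vector_matrix_mult_replace_row)
    then show ?thesis
      using u by (simp add: row_dist_def vector_matrix_mult_replace_row norm_eq_1)
  qed
  obtain C where C: "pairwise orthogonal C" "\<And>x. x \<in> C \<Longrightarrow> norm x = 1"
      "independent C" "card C = dim H" "span C = H"
    using orthonormal_basis_subspace[OF H(1)] by metis
  \<comment> \<open>The inner law below depends on \<open>A\<close> only through this
    dimension.\<close>
  have dim: "AE A in std_gaussian. dim (?W A) = dim H"
    using AE_dim_rows[of C] C H independent_imp_finite by auto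
  have "emeasure (distr std_gaussian borel (\<lambda>A :: real ^ 'd ^ 'D. (row_dist u H A)\<^sup>2)) E
      = (\<integral>\<^sup>+A. indicator E ((row_dist u H A)\<^sup>2) \<partial>(std_gaussian :: (real ^ 'd ^ 'D) measure))"
    by (simp add: nn_integral_indicator[symmetric] nn_integral_distr del: nn_integral_indicator)
  also have "\<dots> = (\<integral>\<^sup>+A. indicator E ((row_dist u H A)\<^sup>2)
      \<partial>distr (std_gaussian \<Otimes>\<^sub>M std_gaussian) borel (\<lambda>(A :: real ^ 'd ^ 'D, g). replace_row u A g))"
    by (simp add: distr_replace_row[OF u])
  also have "\<dots> = (\<integral>\<^sup>+z. indicator E ((row_dist u H (case z of (A, g) \<Rightarrow> replace_row u A g))\<^sup>2)
      \<partial>(std_gaussian \<Otimes>\<^sub>M (std_gaussian :: (real ^ 'd) measure)))"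
    by (subst nn_integral_distr) auto
  also have "\<dots> = (\<integral>\<^sup>+A. \<integral>\<^sup>+g. indicator E ((infdist g (?W A))\<^sup>2) \<partial>std_gaussian \<partial>std_gaussian)"
    by (subst P.M2.nn_integral_fst[symmetric]) (auto simp: row)
  also have "\<dots> = (\<integral>\<^sup>+A. emeasure (chi_squared (CARD('d) - dim (?W A))) E \<partial>std_gaussian)"
  proof (rule nn_integral_cong)
    fix A
    have "(\<lambda>g. (infdist g (?W A))\<^sup>2) \<in> borel_measurable borel"
      by (intro borel_measurable_continuous_onI continuous_intros)
    then show "(\<integral>\<^sup>+g. indicator E ((infdist g (?W A))\<^sup>2) \<partial>std_gaussian)
        = emeasure (chi_squared (CARD('d) - dim (?W A))) E"
      by (simp add: nn_integral_indicator[symmetric] nn_integral_distr chi_squared_def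
          flip: distr_std_gaussian_infdist[OF sub, of A, simplified] del: nn_integral_indicator)
  qed
  also have "\<dots> = (\<integral>\<^sup>+A. emeasure (chi_squared (CARD('d) - dim H)) E
      \<partial>(std_gaussian :: (real ^ 'd ^ 'D) measure))"
    using dim by (intro nn_integral_cong_AE) auto
  also have "\<dots> = emeasure (chi_squared (CARD('d) - dim H)) E"
    using P.M1.emeasure_space_1 by simp
  finally show "emeasure (distr std_gaussian borel (\<lambda>A :: real ^ 'd ^ 'D. (row_dist u H A)\<^sup>2)) E
      = emeasure (chi_squared (CARD('d) - dim H)) E" .
qed

section \<open>From independent entries to the Gaussian law on matrices\<close>

lemma gaussian_matrix_law:
  fixes A :: "'w \<Rightarrow> real ^ 'd ^ 'D"
  assumes M: "prob_space M" and A: "gaussian_matrix M A"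
  shows "A \<in> borel_measurable M" and "distr M borel A = std_gaussian"
proof -
  interpret prob_space M by fact
  define X where "X = (\<lambda>(i, j) \<omega>. A \<omega> $ i $ j)"
  \<comment> \<open>\<open>a\<close> lists the standard basis matrices by entry position;
    \<open>r\<close> recovers the position from a basis matrix.\<close>
  define a where "a = (\<lambda>(i :: 'D, j :: 'd). axis i (axis j 1) :: real ^ 'd ^ 'D)"
  define r where "r = inv_into UNIV a"
  have a_range: "range a = Basis"
    by (auto simp: a_def Basis_vec_def)
  have r: "inj_on r Basis" and a_r: "\<And>b. b \<in> Basis \<Longrightarrow> a (r b) = b"
    using a_range by (auto simp: r_def inj_on_inv_into f_inv_into_f)
  have Aa: "A \<omega> \<bullet> a p = X p \<omega>" for \<omega> p
    by (cases p) (simp add: a_def X_def inner_axis)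
  have indep: "indep_vars (\<lambda>_. borel) X UNIV"
    using A by (simp add: gaussian_matrix_def X_def)
  have X_distr: "distributed M lborel (X p) std_normal_density" for p
    using A by (cases p) (simp add: gaussian_matrix_def X_def)
  have X[measurable]: "X p \<in> borel_measurable M" for p
    using distributed_measurable[OF X_distr[of p]] by simp
  have X_law: "distr M borel (X p) = std_normal_distribution" for p
  proof -
    have "distr M borel (X p) = distr M lborel (X p)"
      by (rule distr_cong) auto
    then show ?thesis
      using X_distr[of p] by (simp add: distributed_def)
  qed
  have A_eq: "A = (\<lambda>\<omega>. \<Sum>b\<in>Basis. X (r b) \<omega> *\<^sub>R b)"
  proof
    fix \<omega>
    have "A \<omega> = (\<Sum>b\<in>Basis. (A \<omega> \<bullet> b) *\<^sub>R b)"
      by (simp add: euclidean_representation)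
    also have "\<dots> = (\<Sum>b\<in>Basis. X (r b) \<omega> *\<^sub>R b)"
      by (intro sum.cong refl) (metis Aa a_r)
    finally show "A \<omega> = (\<Sum>b\<in>Basis. X (r b) \<omega> *\<^sub>R b)" .
  qed
  show "A \<in> borel_measurable M"
    by (subst A_eq) measurable
  let ?N = "\<lambda>_. std_normal_distribution"
  \<comment> \<open>Independence enters here: the joint law of the entries is the product of their
    laws.\<close>
  have joint: "distr M (PiM UNIV (\<lambda>_. borel)) (\<lambda>\<omega>. \<lambda>p\<in>UNIV. X p \<omega>) = PiM UNIV ?N"
    using indep indep_vars_iff_distr_eq_PiM[where I = UNIV and X = X and M' = "\<lambda>_. borel"] X by (simp add: X_law)
  have m1: "(\<lambda>x. \<lambda>b\<in>Basis. x (r b)) \<in> measurable (PiM UNIV (\<lambda>_. borel)) (PiM Basis ?N)"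
    by (intro measurable_restrict) auto
  have m2: "(\<lambda>x. \<Sum>b\<in>Basis. x b *\<^sub>R (b :: real ^ 'd ^ 'D)) \<in> borel_measurable (PiM Basis ?N)"
    by measurable
  have m0: "(\<lambda>\<omega>. \<lambda>p\<in>UNIV. X p \<omega>) \<in> measurable M (PiM UNIV (\<lambda>_. borel))"
    by (intro measurable_restrict) auto
  have "(std_gaussian :: (real ^ 'd ^ 'D) measure) = distr (PiM Basis ?N) borel (\<lambda>x. \<Sum>b\<in>Basis. x b *\<^sub>R b)"
    by (rule std_gaussian_eq_PiM)
  also have "PiM (Basis :: (real ^ 'd ^ 'D) set) ?N
      = distr (PiM UNIV ?N) (PiM Basis ?N) (\<lambda>x. \<lambda>b\<in>Basis. x (r b))"
    using distr_PiM_reindex[of UNIV ?N r Basis] r prob_space_normal_density[of 1 0] by simp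
  also have "\<dots> = distr M (PiM Basis ?N) (\<lambda>\<omega>. \<lambda>b\<in>Basis. X (r b) \<omega>)"
    unfolding joint[symmetric] using m1 m0 by (subst distr_distr) (auto simp: comp_def)
  also have "distr \<dots> borel (\<lambda>x. \<Sum>b\<in>Basis. x b *\<^sub>R b) = distr M borel A"
    using m2 measurable_comp[OF m0 m1]
    by (subst distr_distr) (auto simp: comp_def A_eq intro!: distr_cong)
  finally show "distr M borel A = std_gaussian" ..
qed

section \<open>The minimal-norm solution for a fixed matrix\<close>

lemma min_norm_solution:
  fixes A :: "real ^ 'd ^ 'D" and T :: "(real ^ 'D) set"
  assumes T: "subspace T" and x: "x \<in> T" "x \<noteq> 0"
  defines "u \<equiv> x /\<^sub>R norm x" and "H \<equiv> {v \<in> T. \<forall>y\<in>span {x}. orthogonal y v}"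
    and "S \<equiv> {y. A *v y \<in> {x + z | z. z \<in> T\<^sup>\<bottom>}}"
  shows "row_dist u H A = 0 \<Longrightarrow> S = {}"
    and "row_dist u H A \<noteq> 0 \<Longrightarrow> S \<noteq> {}"
    and "row_dist u H A \<noteq> 0 \<Longrightarrow> norm (arg_min norm (\<lambda>y. y \<in> S)) = norm x / row_dist u H A"
proof -
  have ux: "u \<bullet> x = norm x" and x_u: "x = norm x *\<^sub>R u" and uu: "u \<bullet> u = 1"
    using x by (simp_all add: u_def dot_square_norm power2_eq_square)
  have H_iff: "v \<in> H \<longleftrightarrow> v \<in> T \<and> v \<bullet> x = 0" for v
  proof -
    have "(\<forall>y\<in>span {x}. orthogonal y v) \<longleftrightarrow> v \<bullet> x = 0"
      by (auto simp: span_singleton orthogonal_def inner_commute)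
    then show ?thesis
      by (simp add: H_def)
  qed
  have H: "subspace H"
    using T by (auto simp: subspace_def H_iff inner_add_left)
  have uT: "u \<in> T"
    using T x by (simp add: u_def subspace_scale)
  have S_iff: "y \<in> S \<longleftrightarrow> (u v* A) \<bullet> y = norm x \<and> (\<forall>v\<in>H. (v v* A) \<bullet> y = 0)" for y
  proof -
    have "y \<in> S \<longleftrightarrow> A *v y - x \<in> T\<^sup>\<bottom>"
      by (auto simp: S_def) (metis add_diff_cancel_left' diff_add_cancel add.commute)+
    also have "\<dots> \<longleftrightarrow> (\<forall>t\<in>T. t \<bullet> (A *v y) = t \<bullet> x)"
      by (auto simp: orthogonal_comp_def orthogonal_def inner_diff_right)
    \<comment> \<open>Each vector of \<open>T\<close> is a multiple of \<open>u\<close> plus a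
      vector of \<open>H\<close>, so testing against \<open>u\<close> and \<open>H\<close>
      suffices.\<close>
    also have "\<dots> \<longleftrightarrow> u \<bullet> (A *v y) = norm x \<and> (\<forall>v\<in>H. v \<bullet> (A *v y) = 0)"
    proof (intro iffI conjI ballI)
      assume "\<forall>t\<in>T. t \<bullet> (A *v y) = t \<bullet> x"
      then show "u \<bullet> (A *v y) = norm x" and "\<And>v. v \<in> H \<Longrightarrow> v \<bullet> (A *v y) = 0"
        using uT ux by (auto simp: H_iff)
    next
      fix t assume *: "u \<bullet> (A *v y) = norm x \<and> (\<forall>v\<in>H. v \<bullet> (A *v y) = 0)" and t: "t \<in> T"
      have "t - (t \<bullet> u) *\<^sub>R u \<in> H"
        using T t uT ux x_u uu
        by (auto simp: H_iff subspace_diff subspace_scale inner_diff_left)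
           (metis inner_scaleR_right mult.commute)
      then have "(t - (t \<bullet> u) *\<^sub>R u) \<bullet> (A *v y) = 0"
        using * by blast
      then have "t \<bullet> (A *v y) = (t \<bullet> u) * norm x"
        using * by (simp add: inner_diff_left)
      also have "\<dots> = t \<bullet> x"
        by (subst (2) x_u) simp
      finally show "t \<bullet> (A *v y) = t \<bullet> x" .
    qed
    finally show ?thesis
      by (simp add: dot_lmul_matrix)
  qed
  define b where "b = u v* A"
  define W where "W = (\<lambda>v. v v* A) ` H"
  have W: "subspace W"
    unfolding W_def by (intro linear_subspace_image linear_vector_matrix_mult H)
  have S_iff': "y \<in> S \<longleftrightarrow> b \<bullet> y = norm x \<and> (\<forall>w\<in>W. w \<bullet> y = 0)" for y
    by (simp add: S_iff b_def W_def)
  obtain w p where w: "w \<in> span W" and p: "\<And>v. v \<in> span W \<Longrightarrow> orthogonal p v" and bwp: "b = w + p"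
    using orthogonal_subspace_decomp_exists[of W b] by metis
  have spW: "span W = W"
    using W by (simp add: span_eq_iff)
  have wW: "w \<in> W"
    using w spW by simp
  have pW: "p \<bullet> v = 0" if "v \<in> W" for v
    using p that spW by (auto simp: orthogonal_def)
  have pW': "v \<bullet> p = 0" if "v \<in> W" for v
    using pW[OF that] by (simp add: inner_commute)
  have dist: "row_dist u H A = norm p"
    using infdist_subspace[OF wW _ W, of b] pW unfolding row_dist_def b_def[symmetric] W_def[symmetric]
    by (simp add: bwp)
  have xpos: "norm x > 0"
    using x by simp
  show "S = {}" if "row_dist u H A = 0"
  proof -
    have "b \<in> W"
      using that wW bwp dist by simp
    then show ?thesis
      using xpos by (auto simp: S_iff')
  qed
  assume nz: "row_dist u H A \<noteq> 0"
  then have pp: "p \<bullet> p \<noteq> 0" "norm p > 0"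
    by (auto simp: dist)
  \<comment> \<open>The scalar makes the inner product of \<open>b\<close> and \<open>y0\<close>
    equal to \<open>norm x\<close>: since \<open>w\<close> is orthogonal to \<open>p\<close>, the
    inner product of \<open>b\<close> and \<open>p\<close> is that of \<open>p\<close> with
    itself.\<close>
  define y0 where "y0 = (norm x / (p \<bullet> p)) *\<^sub>R p"
  have y0: "y0 \<in> S"
    using pp pW' wW by (auto simp: S_iff' y0_def bwp inner_add_left)
  have norm_y0: "norm y0 = norm x / norm p"
    using pp by (simp add: y0_def dot_square_norm power2_eq_square)
  have "norm y0 \<le> norm y" if "y \<in> S" for y
  proof -
    \<comment> \<open>Elements of \<open>S\<close> are orthogonal to \<open>w\<close>, so
      \<open>b\<close> may be replaced by \<open>p\<close> before applying Cauchy-Schwarz.\<close>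
    have "norm x = p \<bullet> y"
      using that wW by (auto simp: S_iff' bwp inner_add_left)
    also have "\<dots> \<le> norm p * norm y"
      by (rule norm_cauchy_schwarz)
    finally show ?thesis
      using pp by (simp add: norm_y0 divide_le_eq mult.commute)
  qed
  \<comment> \<open>Whichever minimizer \<open>arg_min\<close> selects, its norm is that of
    \<open>y0\<close>.\<close>
  then show "norm (arg_min norm (\<lambda>y. y \<in> S)) = norm x / row_dist u H A"
    using arg_min_equality[of "\<lambda>y. y \<in> S" y0 norm] y0 norm_y0 dist by simp
  show "S \<noteq> {}"
    using y0 by auto
qed

section \<open>Law of the norm ratio\<close>

theorem theorem3p7:
  fixes f :: "real ^ 'D \<Rightarrow> real" and fstar :: real
    and T G Gstar :: "(real ^ 'D) set"
    and U :: "real ^ 'e ^ 'D"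
    and xstar xtop :: "real ^ 'D"
    and M :: "'w measure"
    and A :: "'w \<Rightarrow> real ^ 'd ^ 'D"
    and S :: "'w \<Rightarrow> (real ^ 'd) set"
    and y2 :: "'w \<Rightarrow> real ^ 'd"
  assumes "continuous_on UNIV f"
    and "attains_global_min f fstar"
    and "effective_dim f = CARD('e)" and "CARD('e) \<le> CARD('d)"
    and "effective_subspace f T"
    and "orthonormal_columns U" and "span (columns U) = T"
    and "G = {x. f x = fstar}" and "xstar \<in> G"
    and "xtop = (U ** transpose U) *v xstar" and "xtop \<noteq> 0"
    and "Gstar = {xtop + z | z. z \<in> T\<^sup>\<bottom>}"
    and "prob_space M" and "gaussian_matrix M A"
    and "S = (\<lambda>\<omega>. {y. A \<omega> *v y \<in> Gstar})"
    and "y2 = (\<lambda>\<omega>. arg_min norm (\<lambda>y. y \<in> S \<omega>))"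
  shows "(AE \<omega> in M. S \<omega> \<noteq> {}) \<and>
    has_law M (\<lambda>\<omega>. (norm xtop)\<^sup>2 / (norm (y2 \<omega>))\<^sup>2) (chi_squared (CARD('d) - CARD('e) + 1))"
proof -
  have T: "subspace T" "dim T = CARD('e)"
    using assms(3,5) by (auto simp: effective_subspace_def constant_along_complement_def)
  have xT: "xtop \<in> T"
    unfolding assms(10) assms(7)[symmetric] matrix_vector_mul_assoc[symmetric]
    by (rule matrix_vector_mult_in_columnspace)
  define u where "u = xtop /\<^sub>R norm xtop"
  define H where "H = {v \<in> T. \<forall>y\<in>span {xtop}. orthogonal y v}"
  note S_def = assms(15)[unfolded assms(12)]
  have u: "norm u = 1"
    using assms(11) by (simp add: u_def)
  have uH: "v \<bullet> u = 0" if "v \<in> H" for v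
    using that span_base[of xtop "{xtop}"] by (auto simp: H_def u_def orthogonal_def inner_commute)
  have H: "subspace H"
  proof -
    have "H = T \<inter> {v. \<forall>y\<in>span {xtop}. orthogonal y v}"
      by (auto simp: H_def)
    then show ?thesis
      using subspace_inter[OF T(1) subspace_orthogonal_to_vectors[of "span {xtop}"]] by simp
  qed
  \<comment> \<open>Splitting off the line through the non-zero \<open>xtop\<close> costs one
    dimension, the source of the +1 in the degrees of freedom.\<close>
  have "dim H + dim (span {xtop}) = dim T"
    unfolding H_def
    by (rule dim_subspace_orthogonal_to_vectors) (use T xT in \<open>simp_all add: span_minimal\<close>)
  then have dimH: "dim H + 1 = CARD('e)"
    using assms(11) T by (simp add: dim_singleton)
  note min = min_norm_solution[OF T(1) xT assms(11), folded u_def H_def]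
  note [measurable] = gaussian_matrix_law(1)[OF assms(13,14)]
  note law = gaussian_matrix_law(2)[OF assms(13,14)]
  let ?d = "\<lambda>\<omega>. row_dist u H (A \<omega>)"
  have "AE B :: real ^ 'd ^ 'D in std_gaussian. u v* B \<notin> (\<lambda>v. v v* B) ` H"
    using dimH assms(4) by (intro AE_row_notin_span u uH H) auto
  then have "AE B :: real ^ 'd ^ 'D in distr M borel A. row_dist u H B \<noteq> 0"
    unfolding law
  proof eventually_elim
    case (elim B)
    have "closed ((\<lambda>v. v v* B) ` H)"
      by (intro closed_subspace linear_subspace_image linear_vector_matrix_mult H)
    with elim show ?case
      using subspace_0[OF H] in_closed_iff_infdist_zero[of "(\<lambda>v. v v* B) ` H" "u v* B"]
      by (auto simp: row_dist_def)
  qed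
  then have nz: "AE \<omega> in M. ?d \<omega> \<noteq> 0"
    by (subst (asm) AE_distr_iff) auto
  \<comment> \<open>The ratio where \<open>S\<close> is empty: \<open>arg_min\<close> over the empty
    set is a fixed unspecified point. As a constant it keeps the ratio measurable on the whole
    space, as \<open>has_law\<close> demands.\<close>
  define c where "c = (norm xtop)\<^sup>2 / (norm (arg_min norm (\<lambda>y :: real ^ 'd. y \<in> {})))\<^sup>2"
  have ratio: "(norm xtop)\<^sup>2 / (norm (y2 \<omega>))\<^sup>2 = (if ?d \<omega> = 0 then c else (?d \<omega>)\<^sup>2)" for \<omega>
  proof (cases "?d \<omega> = 0")
    case True
    then have "S \<omega> = {}"
      unfolding S_def by (rule min(1))
    then show ?thesis
      by (simp only: assms(16) c_def True simp_thms if_True)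
  next
    case False
    then have "norm (y2 \<omega>) = norm xtop / ?d \<omega>"
      unfolding assms(16) S_def by (rule min(3))
    then show ?thesis
      using False assms(11) by (simp add: power_divide)
  qed
  have meas: "(\<lambda>\<omega>. (norm xtop)\<^sup>2 / (norm (y2 \<omega>))\<^sup>2) \<in> borel_measurable M"
    unfolding ratio by measurable
  have "distr M borel (\<lambda>\<omega>. (norm xtop)\<^sup>2 / (norm (y2 \<omega>))\<^sup>2) = distr M borel (\<lambda>\<omega>. (?d \<omega>)\<^sup>2)"
  proof (intro distr_cong_AE refl meas)
    show "AE \<omega> in M. (norm xtop)\<^sup>2 / (norm (y2 \<omega>))\<^sup>2 = (?d \<omega>)\<^sup>2"
      using nz by eventually_elim (simp add: ratio)
  qed measurable
  also have "\<dots> = distr (distr M borel A) borel (\<lambda>B. (row_dist u H B)\<^sup>2)"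
    by (subst distr_distr) (auto simp: comp_def)
  also have "\<dots> = chi_squared (CARD('d) - dim H)"
    unfolding law using dimH assms(4) by (intro distr_row_dist u uH H) auto
  \<comment> \<open>Subtraction of naturals truncates, so this equality relies on
    \<open>CARD('e) \<le> CARD('d)\<close>.\<close>
  also have "CARD('d) - dim H = CARD('d) - CARD('e) + 1"
    using dimH assms(4) by simp
  finally have "distr M borel (\<lambda>\<omega>. (norm xtop)\<^sup>2 / (norm (y2 \<omega>))\<^sup>2)
      = chi_squared (CARD('d) - CARD('e) + 1)" .
  moreover have "AE \<omega> in M. S \<omega> \<noteq> {}"
    using nz by eventually_elim (use min(2) in \<open>auto simp: S_def\<close>)
  ultimately show ?thesis
    using meas by (simp add: has_law_def)
qed

end
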